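(* Let $\nu\ge0$, let $z\in\mathbb{C}\setminus\{0\}$ with $-\pi<\arg z\le\pi$, and let $\kappa,\mu,s\in\mathbb{C}$ with $\Re(s)>\nu$ and $\Re(\mu\pm\kappa+\frac12)>0$. Then $$\int_0^\infty p^{s-1}M_{\kappa,\mu}^{(p,\nu)}(z)\,dp=\frac{2^{s-1}z^{\mu+\frac12}e^{-z/2}}{\sqrt{\pi}\,B(\mu-\kappa+\frac12,\mu+\kappa+\frac12)}\,\Gamma\left(\frac{s-\nu}{2}\right)\Gamma\left(\frac{s+\nu+1}{2}\right)$$ $$\times\,B\left(\mu-\kappa+s+\tfrac12,\,\mu+\kappa+s+\tfrac12\right)\,\Phi\left(\mu-\kappa+s+\tfrac12;\,2\mu+2s+1;\,z\right).$$
   Context: $B(x,y)=\Gamma(x)\Gamma(y)/\Gamma(x+y)$ is the Beta function, $K_\lambda$ is the modified Bessel function of the second kind, and $\Phi(b;c;z)=\sum_{n=0}^\infty\frac{(b)_n}{(c)_n}\frac{z^n}{n!}$ is the ordinary confluent hypergeometric function, with $(a)_n=\Gamma(a+n)/\Gamma(a)$. Complex powers of $z$ are principal. For $\Re(p)>0$, $\nu\ge 0$, the extended Beta function is $$B_{p,\nu}(x,y)=\sqrt{\frac{2p}{\pi}}\int_0^1 t^{x-\frac32}(1-t)^{y-\frac32}K_{\nu+\frac12}\left(\frac{p}{t(1-t)}\right)dt.$$ The $(p,\nu)$-extended confluent hypergeometric function is $$\Phi_{p,\nu}(b;c;z)=\sum_{m=0}^\infty\frac{B_{p,\nu}(b+m,c-b)}{B(b,c-b)}\frac{z^m}{m!}=\frac{1}{B(b,c-b)}\sqrt{\frac{2p}{\pi}}\int_0^1t^{b-\frac32}(1-t)^{c-b-\frac32}e^{zt}K_{\nu+\frac12}\left(\frac{p}{t(1-t)}\right)dt.$$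 The $(p,\nu)$-extended Whittaker function is $$M_{\kappa,\mu}^{(p,\nu)}(z)=z^{\mu+\frac12}e^{-z/2}\,\Phi_{p,\nu}(\mu-\kappa+\tfrac12;2\mu+1;z).$$ *)

theory Defs
  imports "HOL-Complex_Analysis.Complex_Analysis"
begin

text \<open>
  The modified Bessel function of the second kind (Macdonald function) of order \<open>\<alpha>\<close>
  is taken in its classical form \<open>\<integral>\<^sub>0\<^sup>\<infinity> exp (-z cosh t) cosh (\<alpha> t) dt\<close>
  for \<open>Re z > 0\<close>, which covers integer and non-integer orders uniformly (with the usual
  normalisation \<open>K(z) \<sim> sqrt (\<pi> / (2z)) exp (-z)\<close>). For other \<open>z\<close> the integral
  does not converge absolutely and the value is a placeholder; only \<open>Re z > 0\<close> is ever used.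
\<close>

definition bessel_K :: "complex \<Rightarrow> complex \<Rightarrow> complex" where
  "bessel_K \<alpha> z =
     (LBINT t:{0<..}. exp (- z * cosh (complex_of_real t)) * cosh (\<alpha> * complex_of_real t))"

definition confluent_Phi :: "complex \<Rightarrow> complex \<Rightarrow> complex \<Rightarrow> complex" where
  "confluent_Phi b c z = (\<Sum>n. pochhammer b n / pochhammer c n * z ^ n / fact n)"

text \<open>
  The extended functions are meant for \<open>Re p > 0\<close> and \<open>\<nu> \<ge> 0\<close>. All complex powers and the
  square root are principal.
\<close>

definition ext_Beta :: "complex \<Rightarrow> real \<Rightarrow> complex \<Rightarrow> complex \<Rightarrow> complex" where
  "ext_Beta p \<nu> x y =
     csqrt (2 * p / of_real pi) *
     (LBINT t:{0<..<1}. complex_of_real t powr (x - 3 / 2)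
        * complex_of_real (1 - t) powr (y - 3 / 2)
        * bessel_K (of_real (\<nu> + 1 / 2)) (p / complex_of_real (t * (1 - t))))"

definition ext_Phi :: "complex \<Rightarrow> real \<Rightarrow> complex \<Rightarrow> complex \<Rightarrow> complex \<Rightarrow> complex" where
  "ext_Phi p \<nu> b c z =
     (\<Sum>m. ext_Beta p \<nu> (b + of_nat m) (c - b) / Beta b (c - b) * z ^ m / fact m)"

definition ext_Whittaker_M ::
    "complex \<Rightarrow> real \<Rightarrow> complex \<Rightarrow> complex \<Rightarrow> complex \<Rightarrow> complex" where
  "ext_Whittaker_M p \<nu> \<kappa> \<mu> z =
     z powr (\<mu> + 1 / 2) * exp (- z / 2) * ext_Phi p \<nu> (\<mu> - \<kappa> + 1 / 2) (2 * \<mu> + 1) z"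

end

theory Submission imports Defs begin

text \<open>
  Everything reduces to absolutely convergent Mellin transforms and Fubini's theorem.
  Integrating \<open>u powr (a + b - 1) * r powr (b - 1) * exp (- u * (1 + r))\<close> over \<open>u, r > 0\<close> in both orders evaluates
  \<open>\<integral> r powr (b - 1) * (1 + r) powr (- a - b)\<close> as the complex Beta function; \<open>r = x / (1 - x)\<close>
  turns this into Euler's integral on the unit interval, and \<open>r = exp (2 t)\<close> into
  \<open>\<integral> cosh (\<alpha> t) / cosh t powr a\<close>, which gives the Mellin transform of \<open>K\<^sub>\<alpha>\<close>.
  Swapping the \<open>p\<close>- and \<open>t\<close>-integrals then yields the Mellin transform of the extended Beta
  function. Its absolute version is bounded by the same formula at the real parts of the
  parameters, uniformly in the index \<open>m\<close> of the defining series of \<open>\<Phi>\<close>, and so the series may be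
  integrated term by term.
\<close>

section \<open>Absolutely convergent integrals over sets, substitution and Fubini\<close>

text \<open>Integrability and value travel together in one statement. As an abbreviation over an
  indicator-weighted integrand, it lets the rules for \<open>has_bochner_integral\<close> apply
  directly.\<close>

abbreviation has_abs_integral ::
    "(real \<Rightarrow> 'a::{banach, second_countable_topology}) \<Rightarrow> 'a \<Rightarrow> real set \<Rightarrow> bool"
    (infixr "has'_abs'_integral" 46) where
  "(f has_abs_integral I) S \<equiv> has_bochner_integral lborel (\<lambda>x. indicator S x *\<^sub>R f x) I"

lemma has_abs_integral_iff:
  "(f has_abs_integral I) S \<longleftrightarrow> set_integrable lborel S f \<and> (LBINT x:S. f x) = I"
  by (simp add: has_bochner_integral_iff set_integrable_def set_lebesgue_integral_def)

lemma has_abs_integral_eq: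
  assumes "(f has_abs_integral I) S" "\<And>x. x \<in> S \<Longrightarrow> f x = g x" "I = J"
  shows "(g has_abs_integral J) S"
proof -
  have "has_bochner_integral lborel (\<lambda>x. indicator S x *\<^sub>R f x) I \<longleftrightarrow>
      has_bochner_integral lborel (\<lambda>x. indicator S x *\<^sub>R g x) J"
    using assms(2,3) by (intro has_bochner_integral_cong) (auto simp: indicator_def)
  with assms(1) show ?thesis by simp
qed

lemma has_abs_integral_mult_right:
  fixes f :: "real \<Rightarrow> 'a::{real_normed_field, banach, second_countable_topology}"
  assumes "(f has_abs_integral I) S"
  shows "((\<lambda>x. c * f x) has_abs_integral c * I) S"
  using has_bochner_integral_mult_right[OF assms, of c] by simp

lemma has_abs_integral_Re:
  assumes "(f has_abs_integral I) S"
  shows "((\<lambda>x. Re (f x)) has_abs_integral Re I) S"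
  using has_bochner_integral_Re[OF assms] by simp

lemma powr_of_real_pos:
  "x > 0 \<Longrightarrow> complex_of_real x powr w = exp (w * of_real (ln x))"
  by (simp add: powr_def Ln_of_real)

text \<open>Continuity fails at the branch cut of the principal power, so the real argument is split
  by sign. Each case is an explicit exponential or the conventional value 0 at 0, and no positivity
  has to be assumed.\<close>

lemma borel_measurable_of_real_powr [measurable]:
  assumes [measurable]: "f \<in> borel_measurable M"
  shows "(\<lambda>x. complex_of_real (f x) powr w) \<in> borel_measurable M"
proof -
  have [simp]: "complex_of_real r powr w =
      (if r = 0 then 0 else if r > 0 then exp (w * of_real (ln r))
       else exp (w * (of_real (ln (- r)) + \<i> * of_real pi)))" for r
    using Ln_minus[of "complex_of_real (- r)"]
    by (auto simp: powr_def Ln_of_real simp flip: of_real_minus)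
  show ?thesis by simp measurable
qed

text \<open>The change of variables holds for absolutely Lebesgue integrable functions. Borel
  measurability on both sides is what moves the result between the completed measure and
  \<open>lborel\<close>.\<close>

lemma has_abs_integral_substitution:
  fixes f :: "real \<Rightarrow> 'a::euclidean_space"
  assumes f: "(f has_abs_integral I) (g ` S)"
    and S: "S \<in> sets borel"
    and g: "\<And>x. x \<in> S \<Longrightarrow> (g has_field_derivative h x) (at x within S)" "inj_on g S"
    and [measurable]: "(\<lambda>x. indicator S x *\<^sub>R \<bar>h x\<bar> *\<^sub>R f (g x)) \<in> borel_measurable borel"
  shows "((\<lambda>x. \<bar>h x\<bar> *\<^sub>R f (g x)) has_abs_integral I) S"
proof -
  have m: "(\<lambda>x. indicator (g ` S) x *\<^sub>R f x) \<in> borel_measurable lborel"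
    using f unfolding has_bochner_integral_iff by (intro borel_measurable_integrable) simp
  have f': "f absolutely_integrable_on g ` S"
    using f m by (simp add: has_bochner_integral_iff set_integrable_def integrable_completion)
  moreover have "integral (g ` S) f = I"
    using f m set_lebesgue_integral_eq_integral(2)[OF f']
    by (simp add: has_bochner_integral_iff set_lebesgue_integral_def integral_completion)
  ultimately have *: "(\<lambda>x. \<bar>h x\<bar> *\<^sub>R f (g x)) absolutely_integrable_on S"
      "integral S (\<lambda>x. \<bar>h x\<bar> *\<^sub>R f (g x)) = I"
    using has_absolute_integral_change_of_variables_real[of S g h f I] S g by auto
  with set_lebesgue_integral_eq_integral(2)[OF *(1)] assms(5) show ?thesis
    by (simp add: has_bochner_integral_iff set_integrable_def set_lebesgue_integral_def
        integrable_completion integral_completion)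
qed

text \<open>Integrability on the product comes from the iterated integral of the norm, supplied in
  closed form by \<open>h\<close> and \<open>H\<close>. The second conclusion feeds the uniform
  bound for termwise integration.\<close>

lemma Fubini_on:
  fixes f :: "real \<Rightarrow> real \<Rightarrow> complex"
  assumes meas: "(\<lambda>(x, y). indicator A x *\<^sub>R indicator B y *\<^sub>R f x y)
      \<in> borel_measurable (lborel \<Otimes>\<^sub>M lborel)"
    and f: "\<And>x. x \<in> A \<Longrightarrow> (f x has_abs_integral g x) B"
    and norm_f: "\<And>x. x \<in> A \<Longrightarrow> ((\<lambda>y. norm (f x y)) has_abs_integral h x) B"
    and h: "(h has_abs_integral H) A"
  shows Fubini_on_integral: "((\<lambda>y. LBINT x:A. f x y) has_abs_integral (LBINT x:A. g x)) B"
    and Fubini_on_norm: "(LBINT y:B. norm (LBINT x:A. f x y)) \<le> H"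
proof -
  \<comment> \<open>Extending by zero makes the slice statements hold for every \<open>x\<close>,
    also outside \<open>A\<close>.\<close>
  define F where "F = (\<lambda>x y. indicator A x *\<^sub>R indicator B y *\<^sub>R f x y)"
  have F1: "has_bochner_integral lborel (F x) (indicator A x *\<^sub>R g x)" for x
    using f[of x] by (auto simp: F_def indicator_def)
  have F2: "has_bochner_integral lborel (\<lambda>y. norm (F x y)) (indicator A x *\<^sub>R h x)" for x
    using norm_f[of x] by (cases "x \<in> A") (auto simp: F_def)
  note F1' = F1[unfolded has_bochner_integral_iff] and F2' = F2[unfolded has_bochner_integral_iff]
  have int: "integrable (lborel \<Otimes>\<^sub>M lborel) (case_prod F)"
  proof (rule lborel_pair.Fubini_integrable)
    show "case_prod F \<in> borel_measurable (lborel \<Otimes>\<^sub>M lborel)"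
      using meas by (simp add: F_def)
    show "integrable lborel (\<lambda>x. LBINT y. norm (case_prod F (x, y)))"
      using h F2' by (simp add: has_bochner_integral_iff)
    show "AE x in lborel. integrable lborel (\<lambda>y. case_prod F (x, y))"
      using F1' by simp
  qed
  have snd: "(LBINT x. F x y) = indicator B y *\<^sub>R (LBINT x:A. f x y)" for y
    by (simp add: F_def set_lebesgue_integral_def mult_ac flip: integral_scaleR_right)
  show "((\<lambda>y. LBINT x:A. f x y) has_abs_integral (LBINT x:A. g x)) B"
    using lborel_pair.integrable_snd[OF int] lborel_pair.Fubini_integral[OF int] F1' snd
    by (simp add: has_bochner_integral_iff set_lebesgue_integral_def)
  have int': "integrable (lborel \<Otimes>\<^sub>M lborel) (\<lambda>(x, y). norm (F x y))"
    using integrable_norm[OF int] by (simp add: case_prod_unfold)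
  have "(LBINT y:B. norm (LBINT x:A. f x y)) = (LBINT y. norm (LBINT x. F x y))"
    unfolding snd set_lebesgue_integral_def by simp
  also have "\<dots> \<le> (LBINT y. LBINT x. norm (F x y))"
    using lborel_pair.integrable_snd[OF int] lborel_pair.integrable_snd[OF int']
    by (intro integral_mono integral_norm_bound) (simp_all add: integrable_norm)
  also have "\<dots> = (LBINT x. LBINT y. norm (F x y))"
    using lborel_pair.Fubini_integral[OF int'] by simp
  also have "\<dots> = H"
    using F2' h by (simp add: has_bochner_integral_iff)
  finally show "(LBINT y:B. norm (LBINT x:A. f x y)) \<le> H" .
qed

section \<open>Gamma and Beta integrals with complex parameters\<close>

lemma has_abs_integral_Gamma_scaled:
  assumes "Re z > 0" "c > 0"
  shows "((\<lambda>u. complex_of_real u powr (z - 1) * exp (- of_real (c * u)))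
      has_abs_integral Gamma z * of_real c powr (- z)) {0<..}"
proof -
  let ?f = "\<lambda>u. complex_of_real u powr (z - 1) * exp (- of_real u)"
  have eq: "?f = (\<lambda>u. complex_of_real u powr (z - 1) / of_real (exp u))"
    by (simp add: exp_minus field_simps exp_of_real)
  have m[measurable]: "?f \<in> borel_measurable borel" by measurable
  have a: "?f absolutely_integrable_on {0<..}"
    using absolutely_integrable_Gamma_integral'[OF assms(1)] by (simp add: eq)
  have "integral {0<..} ?f = Gamma z"
    using Gamma_integral_complex'[OF assms(1)] by (simp add: eq has_integral_iff)
  with a set_lebesgue_integral_eq_integral(2)[OF a] have 1: "(?f has_abs_integral Gamma z) {0<..}"
    by (simp add: has_bochner_integral_iff set_integrable_def set_lebesgue_integral_def
        integrable_completion integral_completion)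
  have "((\<lambda>u. ?f (c * u)) has_abs_integral Gamma z /\<^sub>R c) {0<..}"
    using 1 assms(2) lborel_has_bochner_integral_real_affine_iff[of c _ "Gamma z" 0]
    by (auto simp: indicator_def zero_less_mult_iff cong: if_cong)
  \<comment> \<open>The factor cancels the power \<open>c powr (z - 1)\<close> produced by the
    scaling. Together with the Jacobian \<open>1 / c\<close> it leaves
    \<open>c powr (- z)\<close>.\<close>
  from has_abs_integral_mult_right[OF this, of "of_real c powr (1 - z)"] show ?thesis
    by (rule has_abs_integral_eq)
       (use assms(2) in \<open>auto simp: powr_times_real powr_of_real_pos ln_mult scaleR_conv_of_real field_simps
          exp_diff exp_add exp_minus exp_of_real\<close>)
qed

lemma norm_powr_of_real_pos: "x > 0 \<Longrightarrow> norm (complex_of_real x powr w) = x powr Re w"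
  by (simp add: powr_of_real_pos powr_def)

lemma Gamma_nonzero_Re_pos: "Re z > 0 \<Longrightarrow> Gamma z \<noteq> 0"
  by (auto simp: Gamma_eq_zero_iff elim!: nonpos_Ints_cases)

lemma has_abs_integral_Beta_halfline:
  assumes a: "Re a > 0" and b: "Re b > 0"
  shows "((\<lambda>r. complex_of_real r powr (b - 1) * of_real (1 + r) powr (- (a + b)))
      has_abs_integral Beta a b) {0<..}"
proof -
  \<comment> \<open>The exponents are arguments of \<open>f\<close>, so that the same kernel can
    also be taken at the real parts of \<open>a\<close> and \<open>b\<close>.\<close>
  define f :: "complex \<Rightarrow> complex \<Rightarrow> real \<Rightarrow> real \<Rightarrow> complex" where "f = (\<lambda>a b u r. of_real u powr (a + b - 1) * of_real r powr (b - 1)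
    * exp (- of_real (u * (1 + r))))"
  have f1: "(f a b u has_abs_integral Gamma b * (of_real u powr (a - 1) * exp (- of_real u))) {0<..}"
    if "Re b > 0" "u \<in> {0<..}" for u a b
  proof (rule has_abs_integral_eq[OF has_abs_integral_mult_right[OF
          has_abs_integral_Gamma_scaled[of b u], of "of_real u powr (a + b - 1) * exp (- of_real u)"]])
    have "complex_of_real u powr (a + b - 1) * of_real u powr - b = of_real u powr (a - 1)"
      by (simp flip: powr_add)
    then show "of_real u powr (a + b - 1) * exp (- of_real u) * (Gamma b * of_real u powr - b) =
        Gamma b * (of_real u powr (a - 1) * exp (- of_real u))"
      by (metis (no_types, opaque_lifting) mult.assoc mult.commute)
  qed (use that in \<open>auto simp: f_def algebra_simps exp_add exp_diff exp_minus divide_inverse\<close>)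
  have f2: "((\<lambda>u. f a b u r) has_abs_integral
      Gamma (a + b) * (of_real r powr (b - 1) * of_real (1 + r) powr (- (a + b)))) {0<..}"
    if "r \<in> {0<..}" for r
    by (rule has_abs_integral_eq[OF has_abs_integral_mult_right[OF
          has_abs_integral_Gamma_scaled[of "a + b" "1 + r"], of "of_real r powr (b - 1)"]])
       (use that a b in \<open>auto simp: f_def algebra_simps exp_add exp_diff exp_minus\<close>)
  \<comment> \<open>For positive \<open>u\<close> and \<open>r\<close> the modulus of the kernel is
    the kernel at the real parts of its parameters, so its integral is again an instance of
    \<open>f1\<close>.\<close>
  have n: "((\<lambda>r. norm (f a b u r)) has_abs_integral
      Re (Gamma (of_real (Re b)) * (of_real u powr (of_real (Re a) - 1) * exp (- of_real u)))) {0<..}"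
    if "u \<in> {0<..}" for u
    by (rule has_abs_integral_eq[OF has_abs_integral_Re[OF f1[of "of_real (Re b)" u "of_real (Re a)"]]])
       (use that b in \<open>auto simp: f_def powr_of_real_pos norm_mult Re_exp Im_exp\<close>)
  have "((\<lambda>u. complex_of_real u powr (w - 1) * exp (- of_real u)) has_abs_integral Gamma w) {0<..}"
    if "Re w > 0" for w
    using has_abs_integral_Gamma_scaled[of w 1] that by simp
  note G = has_abs_integral_mult_right[OF this]
  have "((\<lambda>r. LBINT u:{0<..}. f a b u r) has_abs_integral
       (LBINT u:{0<..}. Gamma b * (of_real u powr (a - 1) * exp (- of_real u)))) {0<..}"
  proof (rule Fubini_on_integral[OF _ f1[OF b] n])
    show "((\<lambda>u. Re (Gamma (of_real (Re b)) * (of_real u powr (of_real (Re a) - 1) * exp (- of_real u))))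
        has_abs_integral Re (Gamma (of_real (Re b)) * Gamma (of_real (Re a)))) {0<..}"
      using a by (intro has_abs_integral_Re G) simp
  qed (simp_all add: f_def case_prod_unfold)
  also have "(LBINT u:{0<..}. Gamma b * (of_real u powr (a - 1) * exp (- of_real u))) = Gamma b * Gamma a"
    using G[OF a, of "Gamma b"] by (simp add: has_abs_integral_iff)
  finally have "((\<lambda>r. Gamma (a + b) * (of_real r powr (b - 1) * of_real (1 + r) powr (- (a + b))))
    has_abs_integral (Gamma b * Gamma a)) {0<..}"
    by (rule has_abs_integral_eq) (use f2 in \<open>auto simp: has_abs_integral_iff\<close>)
  moreover have "Gamma (a + b) \<noteq> 0"
    using a b by (intro Gamma_nonzero_Re_pos) simp
  ultimately show ?thesis
    by (auto intro: has_abs_integral_eq[OF has_abs_integral_mult_right[where c = "1 / Gamma (a + b)"]]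
        simp: Beta_def)
qed

lemma has_abs_integral_Beta_complex:
  assumes "Re a > 0" "Re b > 0"
  shows "((\<lambda>t. complex_of_real t powr (a - 1) * of_real (1 - t) powr (b - 1))
      has_abs_integral Beta a b) {0<..<1}"
proof -
  let ?g = "\<lambda>x::real. x / (1 - x)"
  have img: "?g ` {0<..<1} = {0<..}"
  proof (intro equalityI subsetI)
    fix r :: real assume "r \<in> {0<..}"
    then show "r \<in> ?g ` {0<..<1}"
      by (intro image_eqI[of _ _ "r / (1 + r)"]) (auto simp: field_simps)
  qed auto
  have "((\<lambda>x. \<bar>1 / (1 - x)\<^sup>2\<bar> *\<^sub>R (complex_of_real (?g x) powr (a - 1) *
      of_real (1 + ?g x) powr (- (b + a)))) has_abs_integral Beta a b) {0<..<1}"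
  proof (rule has_abs_integral_substitution)
    \<comment> \<open>The roles of \<open>a\<close> and \<open>b\<close> are swapped in the
      half-line integral, so that the power of \<open>x / (1 - x)\<close> supplies the factor with
      exponent \<open>a - 1\<close>.\<close>
    show "((\<lambda>x. complex_of_real x powr (a - 1) * complex_of_real (1 + x) powr - (b + a))
        has_abs_integral Beta a b) (?g ` {0<..<1})"
      unfolding img using has_abs_integral_Beta_halfline[of b a] assms by (simp add: Beta_commute)
    show "(?g has_field_derivative 1 / (1 - x)\<^sup>2) (at x within {0<..<1})" if "x \<in> {0<..<1}" for x
      using that by (auto intro!: derivative_eq_intros simp: power2_eq_square field_simps)
    show "inj_on ?g {0<..<1}"
      by (auto simp: inj_on_def field_simps)
    show "(\<lambda>x. indicator {0<..<1} x *\<^sub>R \<bar>1 / (1 - x)\<^sup>2\<bar> *\<^sub>R (complex_of_real (?g x) powr (a - 1) *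
        of_real (1 + ?g x) powr - (b + a))) \<in> borel_measurable borel"
      by measurable
  qed simp
  then show ?thesis
  proof (rule has_abs_integral_eq)
    fix x :: real assume x: "x \<in> {0<..<1}"
    have 1: "1 + ?g x = 1 / (1 - x)" using x by (simp add: field_simps)
    \<comment> \<open>All factors, the Jacobian included, become exponentials in \<open>ln x\<close>
      and \<open>ln (1 - x)\<close>. The identity is then linear in the exponents.\<close>
    have "1 / (1 - x)\<^sup>2 = exp (- 2 * ln (1 - x))"
      using x by (simp add: exp_minus exp_double divide_simps)
    then have "\<bar>1 / (1 - x)\<^sup>2\<bar> *\<^sub>R (complex_of_real (?g x) powr (a - 1) * of_real (1 + ?g x) powr (- (b + a)))
      = exp (- 2 * of_real (ln (1 - x))) * (exp ((a - 1) * of_real (ln x - ln (1 - x)))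
        * exp (- (b + a) * of_real (- ln (1 - x))))"
      using x powr_of_real_pos[of "?g x" "a - 1"] powr_of_real_pos[of "1 + ?g x" "- (b + a)"]
      unfolding 1 by (simp add: scaleR_conv_of_real ln_div ln_inverse flip: exp_of_real)
    also have "\<dots> = exp ((a - 1) * of_real (ln x)) * exp ((b - 1) * of_real (ln (1 - x)))"
      unfolding mult_exp_exp by (rule arg_cong[where f = exp]) (simp add: algebra_simps)
    finally show "\<bar>1 / (1 - x)\<^sup>2\<bar> *\<^sub>R (complex_of_real (?g x) powr (a - 1) *
      of_real (1 + ?g x) powr (- (b + a))) = complex_of_real x powr (a - 1) * of_real (1 - x) powr (b - 1)"
      using x powr_of_real_pos[of x] powr_of_real_pos[of "1 - x"] by simp
  qed simp
qed

section \<open>The Mellin transform of the Macdonald function\<close>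

text \<open>The half-line Beta integral becomes an integral over the whole line with
  \<open>exp (\<alpha> * t)\<close> in place of the hyperbolic cosine. Folding the negative half
  onto the positive one symmetrises the exponential.\<close>

lemma has_abs_integral_exp_cosh:
  assumes "Re a > \<bar>\<alpha>\<bar>"
  shows "((\<lambda>t. cosh (of_real (\<alpha> * t)) * complex_of_real (cosh t) powr (- a)) has_abs_integral
       2 powr (a - 2) * Beta ((a - of_real \<alpha>) / 2) ((a + of_real \<alpha>) / 2)) {0<..}"
proof -
  let ?G = "\<lambda>t. exp (of_real (\<alpha> * t)) * complex_of_real (cosh t) powr (- a)"
  let ?g = "\<lambda>x::real. exp (2 * x)"
  let ?b = "(a + of_real \<alpha>) / 2"
  let ?B = "Beta ((a - of_real \<alpha>) / 2) ?b"
  have img: "range ?g = {0<..}"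
  proof (intro equalityI subsetI)
    fix r :: real assume "r \<in> {0<..}"
    then show "r \<in> range ?g"
      by (intro image_eqI[of _ _ "ln r / 2"]) (auto simp: field_simps)
  qed auto
  have "((\<lambda>x. \<bar>2 * exp (2 * x)\<bar> *\<^sub>R (complex_of_real (?g x) powr (?b - 1) *
      of_real (1 + ?g x) powr (- a))) has_abs_integral ?B) UNIV"
  proof (rule has_abs_integral_substitution)
    have "(a - complex_of_real \<alpha>) / 2 + ?b = a" by (simp add: field_simps)
    then show "((\<lambda>x. complex_of_real x powr (?b - 1) * complex_of_real (1 + x) powr - a)
        has_abs_integral ?B) (range ?g)"
      unfolding img using has_abs_integral_Beta_halfline[of "(a - of_real \<alpha>) / 2" ?b] assms by simp
    show "(?g has_field_derivative (2 * exp (2 * x))) (at x within UNIV)" for x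
      by (auto intro!: derivative_eq_intros)
    show "inj ?g"
      by (auto simp: inj_on_def)
    show "(\<lambda>x. indicator UNIV x *\<^sub>R \<bar>2 * exp (2 * x)\<bar> *\<^sub>R (complex_of_real (?g x) powr (?b - 1) *
        of_real (1 + ?g x) powr - a)) \<in> borel_measurable borel"
      by measurable
  qed simp
  \<comment> \<open>Since \<open>1 + exp (2 * x) = 2 * exp x * cosh x\<close>, the substitution
    leaves the constant \<open>2 powr (1 - a)\<close>: a 2 from the Jacobian and
    \<open>2 powr (- a)\<close> from the power.\<close>
  from has_abs_integral_mult_right[OF this, of "2 powr (a - 1)"]
  have "(?G has_abs_integral 2 powr (a - 1) * ?B) UNIV"
  proof (rule has_abs_integral_eq)
    fix x :: real
    have "1 + ?g x = exp x * (2 * cosh x)"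
      using exp_double[of x] by (simp add: cosh_def algebra_simps exp_minus power2_eq_square)
    then have 1: "ln (1 + ?g x) = x + ln 2 + ln (cosh x)" and "1 + ?g x > 0"
      by (simp_all add: ln_mult cosh_real_pos)
    have two: "2 * exp (2 * x) = exp (ln 2 + 2 * x)" by (simp add: exp_add)
    have "2 powr (a - 1) * (\<bar>2 * exp (2 * x)\<bar> *\<^sub>R (complex_of_real (?g x) powr (?b - 1) *
      of_real (1 + ?g x) powr (- a))) = exp ((a - 1) * of_real (ln 2)) * (exp (of_real (ln 2 + 2 * x)) *
        (exp ((?b - 1) * of_real (2 * x)) * exp (- a * of_real (x + ln 2 + ln (cosh x)))))"
      using powr_of_real_pos[of "?g x" "?b - 1"] powr_of_real_pos[of "1 + ?g x" "- a"]
        powr_of_real_pos[of 2 "a - 1"] \<open>1 + ?g x > 0\<close>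
      unfolding 1 two by (simp add: scaleR_conv_of_real flip: exp_of_real)
    also have "\<dots> = exp (of_real (\<alpha> * x)) * exp (- a * of_real (ln (cosh x)))"
      unfolding mult_exp_exp by (rule arg_cong[where f = exp]) (simp add: field_simps)
    finally show "2 powr (a - 1) * (\<bar>2 * exp (2 * x)\<bar> *\<^sub>R (complex_of_real (?g x) powr (?b - 1) *
      of_real (1 + ?g x) powr (- a))) = ?G x"
      using powr_of_real_pos[of "cosh x" "- a"] by (simp add: cosh_real_pos)
  qed simp
  then have G: "has_bochner_integral lborel ?G (2 powr (a - 1) * ?B)" by simp
  have pos: "(?G has_abs_integral (LBINT t:{0<..}. ?G t)) {0<..}"
    and neg: "(?G has_abs_integral (LBINT t:{..<0}. ?G t)) {..<0}"
    using G by (auto simp: has_bochner_integral_iff set_lebesgue_integral_def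
      intro!: integrable_mult_indicator)
  have "has_bochner_integral lborel (\<lambda>t. indicator {0<..} t *\<^sub>R ?G t + indicator {..<0} t *\<^sub>R ?G t)
      ((LBINT t:{0<..}. ?G t) + (LBINT t:{..<0}. ?G t))"
    by (rule has_bochner_integral_add[OF pos neg])
  moreover have "AE t in lborel. indicator {0<..} t *\<^sub>R ?G t + indicator {..<0} t *\<^sub>R ?G t = ?G t"
    using AE_lborel_singleton[of 0] by eventually_elim (auto simp: indicator_def)
  ultimately have sum: "(LBINT t:{0<..}. ?G t) + (LBINT t:{..<0}. ?G t) = 2 powr (a - 1) * ?B"
    using G
    by (subst (asm) has_bochner_integral_cong_AE) (auto dest: has_bochner_integral_eq)
  have "((\<lambda>t. ?G (- t)) has_abs_integral (LBINT t:{..<0}. ?G t)) {0<..}"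
    using iffD1[OF lborel_has_bochner_integral_real_affine_iff[of "-1" _ _ 0] neg]
    by (simp add: indicator_def cong: if_cong)
  from has_bochner_integral_add[OF pos this]
  have "((\<lambda>t. ?G t + ?G (- t)) has_abs_integral 2 powr (a - 1) * ?B) {0<..}"
    unfolding sum by (simp add: scaleR_add_right)
  \<comment> \<open>The half in the definition of \<open>cosh\<close> lowers the power of 2 from
    \<open>a - 1\<close> to \<open>a - 2\<close>.\<close>
  from has_abs_integral_mult_right[OF this, of "1 / 2"] show ?thesis
    by (rule has_abs_integral_eq)
       (auto simp: cosh_def powr_diff field_simps scaleR_conv_of_real)
qed

lemma borel_measurable_cosh [measurable]:
  assumes "f \<in> borel_measurable M"
  shows "(\<lambda>x. cosh (f x :: complex)) \<in> borel_measurable M"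
  by (rule measurable_compose[OF assms])
     (intro borel_measurable_continuous_onI continuous_intros)

text \<open>An integral of a jointly measurable integrand is measurable in its parameter. This
  covers points without absolute convergence as well, where the integral has its default
  value.\<close>

lemma borel_measurable_bessel_K [measurable]: "bessel_K \<alpha> \<in> borel_measurable borel"
proof -
  have "(\<lambda>z. LBINT t. indicator {0<..} t *\<^sub>R (exp (- z * cosh (complex_of_real t)) * cosh (\<alpha> * of_real t)))
      \<in> borel_measurable borel"
    by (intro sigma_finite_measure.borel_measurable_lebesgue_integral sigma_finite_lborel)
       measurable
  then show ?thesis
    by (simp add: bessel_K_def [abs_def] set_lebesgue_integral_def)
qed

lemma cosh_complex_of_real: "cosh (complex_of_real x) = of_real (cosh x)"
  by (simp add: cosh_def scaleR_conv_of_real flip: exp_of_real)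

lemma bessel_K_real:
  "bessel_K (of_real \<alpha>) (of_real u) = of_real (LBINT t:{0<..}. exp (- u * cosh t) * cosh (\<alpha> * t))"
proof -
  have "exp (- of_real u * cosh (complex_of_real t)) * cosh (of_real \<alpha> * of_real t)
      = complex_of_real (exp (- u * cosh t) * cosh (\<alpha> * t))" for t
    using cosh_complex_of_real[of t] cosh_complex_of_real[of "\<alpha> * t"] by (simp flip: exp_of_real)
  then show ?thesis
    by (simp add: bessel_K_def flip: set_integral_complex_of_real)
qed

text \<open>The integrand is nonnegative, so the kernel carries no phase. Taking norms in the
  integrals below therefore affects only the powers.\<close>

lemma norm_bessel_K_real:
  "norm (bessel_K (of_real \<alpha>) (of_real u)) = Re (bessel_K (of_real \<alpha>) (of_real u))"
proof -
  have "(LBINT t:{0<..}. exp (- u * cosh t) * cosh (\<alpha> * t)) \<ge> 0"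
    unfolding set_lebesgue_integral_def by (intro Bochner_Integration.integral_nonneg) (simp add: cosh_real_nonneg)
  then show ?thesis by (simp add: bessel_K_real)
qed

lemma has_abs_integral_Mellin_bessel_K:
  assumes a: "Re a > \<bar>\<alpha>\<bar>"
  shows "((\<lambda>u. complex_of_real u powr (a - 1) * bessel_K (of_real \<alpha>) (of_real u)) has_abs_integral
      2 powr (a - 2) * Gamma ((a - of_real \<alpha>) / 2) * Gamma ((a + of_real \<alpha>) / 2)) {0<..}"
proof -
  define f :: "complex \<Rightarrow> real \<Rightarrow> real \<Rightarrow> complex" where "f = (\<lambda>a t u. of_real u powr (a - 1)
    * (exp (- of_real u * cosh (of_real t)) * cosh (of_real \<alpha> * of_real t)))"
  define g :: "complex \<Rightarrow> real \<Rightarrow> complex" where "g = (\<lambda>a t. Gamma a *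
    (cosh (of_real (\<alpha> * t)) * complex_of_real (cosh t) powr (- a)))"
  let ?I = "\<lambda>a. 2 powr (a - 2) * Beta ((a - of_real \<alpha>) / 2) ((a + of_real \<alpha>) / 2)"
  have f: "(f a t has_abs_integral g a t) {0<..}" if "Re a > 0" for a t
    by (rule has_abs_integral_eq[OF has_abs_integral_mult_right[OF
          has_abs_integral_Gamma_scaled[of a "cosh t"], of "cosh (of_real (\<alpha> * t))"]])
       (use that in \<open>auto simp: f_def g_def cosh_complex_of_real cosh_real_pos mult_ac simp flip: of_real_mult\<close>)
  have n: "((\<lambda>u. norm (f a t u)) has_abs_integral Re (g (of_real (Re a)) t)) {0<..}" for t
    by (rule has_abs_integral_eq[OF has_abs_integral_Re[OF f[of "of_real (Re a)" t]]])
       (use a in \<open>auto simp: f_def norm_mult powr_of_real_pos cosh_complex_of_real cosh_real_nonneg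
          Re_exp Im_exp simp flip: of_real_mult\<close>)
  have g: "(g a has_abs_integral Gamma a * ?I a) {0<..}" if "Re a > \<bar>\<alpha>\<bar>" for a
    unfolding g_def by (intro has_abs_integral_mult_right has_abs_integral_exp_cosh that)
  have "((\<lambda>u. LBINT t:{0<..}. f a t u) has_abs_integral (LBINT t:{0<..}. g a t)) {0<..}"
  proof (rule Fubini_on_integral[OF _ f n])
    show "((\<lambda>t. Re (g (of_real (Re a)) t)) has_abs_integral
        Re (Gamma (of_real (Re a)) * ?I (of_real (Re a)))) {0<..}"
      using a by (intro has_abs_integral_Re g) simp
    show "(\<lambda>(t, u). indicator {0<..} t *\<^sub>R indicator {0<..} u *\<^sub>R f a t u)
        \<in> borel_measurable (lborel \<Otimes>\<^sub>M lborel)"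
      unfolding f_def by measurable
  qed (use a in auto)
  also have "(LBINT t:{0<..}. g a t) = Gamma a * ?I a"
    using g[OF a] by (simp add: has_abs_integral_iff)
  \<comment> \<open>The two Beta parameters add up to \<open>a\<close>, so the denominator of Beta
    cancels the \<open>Gamma a\<close> of the inner integral.\<close>
  also have "\<dots> = 2 powr (a - 2) * Gamma ((a - of_real \<alpha>) / 2) * Gamma ((a + of_real \<alpha>) / 2)"
  proof -
    have "(a - of_real \<alpha>) / 2 + (a + of_real \<alpha>) / 2 = a" by (simp add: field_simps)
    moreover have "Gamma a \<noteq> 0"
      using a by (intro Gamma_nonzero_Re_pos) simp
    ultimately show ?thesis by (simp add: Beta_def)
  qed
  finally show ?thesis
    by (rule has_abs_integral_eq) (simp_all add: f_def bessel_K_def)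
qed

section \<open>The Mellin transform of the extended Beta function\<close>

text \<open>This is the part of the transform that depends only on \<open>\<nu>\<close> and
  \<open>s\<close>. It passes unchanged through the \<open>t\<close>-integral and the
  series.\<close>

definition Mellin_factor :: "real \<Rightarrow> complex \<Rightarrow> complex" where
  "Mellin_factor \<nu> s = 2 powr (s - 1) / of_real (sqrt pi)
     * Gamma ((s - of_real \<nu>) / 2) * Gamma ((s + of_real \<nu> + 1) / 2)"

text \<open>The square root of \<open>p\<close> shifts the Mellin exponent to
  \<open>s + 1 / 2\<close>. With order \<open>\<nu> + 1 / 2\<close>, convergence then requires
  exactly \<open>Re s > \<nu>\<close>, and the Gamma arguments become those of
  \<open>Mellin_factor\<close>.\<close>

lemma has_abs_integral_Mellin_bessel_K_scaled:
  assumes "\<nu> \<ge> 0" "Re s > \<nu>" "w > 0"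
  shows "((\<lambda>p. complex_of_real p powr (s - 1) * (of_real (sqrt (2 * p / pi)) *
      bessel_K (of_real (\<nu> + 1 / 2)) (of_real (p / w)))) has_abs_integral
      Mellin_factor \<nu> s * of_real w powr (s + 1 / 2)) {0<..}"
proof -
  let ?K = "\<lambda>p. bessel_K (of_real (\<nu> + 1 / 2)) (complex_of_real p)"
  let ?f = "\<lambda>u. complex_of_real u powr (s + 1 / 2 - 1) * ?K u"
  let ?C = "2 powr (s + 1 / 2 - 2) * Gamma ((s + 1 / 2 - of_real (\<nu> + 1 / 2)) / 2)
    * Gamma ((s + 1 / 2 + of_real (\<nu> + 1 / 2)) / 2)"
  have "(?f has_abs_integral ?C) {0<..}"
    using assms by (intro has_abs_integral_Mellin_bessel_K) simp
  then have "((\<lambda>p. ?f (p / w)) has_abs_integral w *\<^sub>R ?C) {0<..}"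
    using assms(3) lborel_has_bochner_integral_real_affine_iff[of "1 / w" _ ?C 0]
    by (auto simp: indicator_def zero_less_divide_iff cong: if_cong)
  \<comment> \<open>The power of \<open>w\<close> undoes the scaling inside
    \<open>(p / w) powr (s - 1 / 2)\<close>. With the Jacobian \<open>w\<close> it gives
    \<open>w powr (s + 1 / 2)\<close>.\<close>
  from has_abs_integral_mult_right[OF this, of "of_real (sqrt (2 / pi)) * of_real w powr (s - 1 / 2)"]
  show ?thesis
  proof (rule has_abs_integral_eq)
    fix p :: real assume p: "p \<in> {0<..}"
    have "complex_of_real p powr (s - 1 / 2) = of_real p powr (s - 1) * of_real p powr (1 / 2)"
      by (simp flip: powr_add)
    also have "complex_of_real p powr (1 / 2) = of_real (sqrt p)"
      using p powr_of_real[of p "1 / 2"] by (simp add: powr_half_sqrt)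
    moreover have "complex_of_real p powr (s - 1 / 2) =
        of_real w powr (s - 1 / 2) * of_real (p / w) powr (s - 1 / 2)"
      using p assms(3) powr_times_real[of "of_real w" "of_real (p / w)" "s - 1 / 2"] by simp
    ultimately have "of_real w powr (s - 1 / 2) * of_real (p / w) powr (s - 1 / 2) =
        of_real p powr (s - 1) * complex_of_real (sqrt p)" by simp
    then show "of_real (sqrt (2 / pi)) * of_real w powr (s - 1 / 2) * ?f (p / w) =
        complex_of_real p powr (s - 1) * (of_real (sqrt (2 * p / pi)) * ?K (p / w))"
      by (simp add: real_sqrt_divide real_sqrt_mult mult_ac)
  next
    have 1: "complex_of_real w powr (s + 1 / 2) = of_real w powr (s - 1 / 2) * of_real w"
      using powr_add[of "complex_of_real w" "s - 1 / 2" 1] assms(3) by (simp add: add.commute)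
    have "2 powr (s - 1) = 2 powr (s + 1 / 2 - 2) * 2 powr (1 / 2 :: complex)"
      by (simp flip: powr_add)
    also have "(2 powr (1 / 2) :: complex) = of_real (sqrt 2)"
      using powr_of_real[of 2 "1 / 2"] by (simp add: powr_half_sqrt)
    finally have 2: "2 powr (s - 1) = 2 powr (s + 1 / 2 - 2) * complex_of_real (sqrt 2)" .
    show "of_real (sqrt (2 / pi)) * of_real w powr (s - 1 / 2) * (w *\<^sub>R ?C) =
        Mellin_factor \<nu> s * of_real w powr (s + 1 / 2)"
      unfolding Mellin_factor_def 1 2
      by (simp add: real_sqrt_divide scaleR_conv_of_real add_ac)
  qed
qed

text \<open>For fixed \<open>t\<close> the scaled Bessel transform applies with
  \<open>w = t * (1 - t)\<close>. Its power of \<open>w\<close> turns the exponents into those of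
  Euler's integral at \<open>x + s\<close> and \<open>y + s\<close>.\<close>

lemma Mellin_ext_Beta:
  assumes \<nu>: "\<nu> \<ge> 0" and s: "Re s > \<nu>" and x: "Re x > 0" and y: "Re y > 0"
  defines "r \<equiv> complex_of_real (Re s)"
  shows has_abs_integral_Mellin_ext_Beta:
      "((\<lambda>p. complex_of_real p powr (s - 1) * ext_Beta (of_real p) \<nu> x y) has_abs_integral
        Mellin_factor \<nu> s * Beta (x + s) (y + s)) {0<..}"
    and norm_integral_Mellin_ext_Beta_le:
      "(LBINT p:{0<..}. norm (complex_of_real p powr (s - 1) * ext_Beta (of_real p) \<nu> x y))
        \<le> Re (Mellin_factor \<nu> r) * Beta (Re x + Re s) (Re y + Re s)"
proof -
  let ?K = "\<lambda>p. bessel_K (of_real (\<nu> + 1 / 2)) (complex_of_real p)"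
  define P :: "complex \<Rightarrow> real \<Rightarrow> complex" where
    "P = (\<lambda>s p. of_real p powr (s - 1) * of_real (sqrt (2 * p / pi)))"
  define T :: "complex \<Rightarrow> complex \<Rightarrow> real \<Rightarrow> complex" where
    "T = (\<lambda>x y t. of_real t powr (x - 3 / 2) * of_real (1 - t) powr (y - 3 / 2))"
  define f where "f = (\<lambda>s x y t p. T x y t * (P s p * ?K (p / (t * (1 - t)))))"
  define g :: "complex \<Rightarrow> complex \<Rightarrow> complex \<Rightarrow> real \<Rightarrow> complex" where
    "g = (\<lambda>s x y t. Mellin_factor \<nu> s *
      (of_real t powr (x + s - 1) * of_real (1 - t) powr (y + s - 1)))"
  have f: "(f s x y t has_abs_integral g s x y t) {0<..}"
    if "Re s > \<nu>" "t \<in> {0<..<1}" for s x y t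
  proof (rule has_abs_integral_eq[OF has_abs_integral_mult_right[OF
          has_abs_integral_Mellin_bessel_K_scaled[OF \<nu> that(1), of "t * (1 - t)"], of "T x y t"]])
    have 1: "complex_of_real (t * (1 - t)) powr (s + 1 / 2)
        = of_real t powr (s + 1 / 2) * of_real (1 - t) powr (s + 1 / 2)"
      using that powr_times_real[of "of_real t" "of_real (1 - t)" "s + 1 / 2"] by simp
    have 2: "w powr (x + s - 1) = w powr (x - 3 / 2) * w powr (s + 1 / 2)" for w x :: complex
      by (subst powr_add [symmetric]) (simp add: algebra_simps)
    show "T x y t * (Mellin_factor \<nu> s * of_real (t * (1 - t)) powr (s + 1 / 2)) = g s x y t"
      unfolding T_def g_def 1 2 by (simp only: mult_ac)
  qed (use that in \<open>auto simp: f_def P_def\<close>)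
  \<comment> \<open>Again the norm is the same kernel at real parameters: \<open>r\<close> for
    \<open>s\<close>, and the real parts of \<open>x\<close> and \<open>y\<close>. The Bessel factor
    is unchanged, being nonnegative.\<close>
  have n: "((\<lambda>p. norm (f s x y t p)) has_abs_integral Re (g r (of_real (Re x)) (of_real (Re y)) t)) {0<..}"
    if t: "t \<in> {0<..<1}" for t
  proof (rule has_abs_integral_eq[OF has_abs_integral_Re[OF f[of r t "of_real (Re x)" "of_real (Re y)"]]])
    fix p :: real assume p: "p \<in> {0<..}"
    have powr_norm: "complex_of_real q powr w = of_real (norm (complex_of_real q powr w'))"
      if "q > 0" "Im w = 0" "Re w = Re w'" for q w w'
      using that by (simp add: norm_powr_of_real_pos complex_eq_iff powr_of_real_pos Re_exp Im_exp powr_def)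
    have K: "?K (p / (t * (1 - t))) = of_real (norm (?K (p / (t * (1 - t)))))"
      by (metis bessel_K_real norm_bessel_K_real Re_complex_of_real)
    have P: "P r p = of_real (norm (P s p))"
      using p unfolding P_def norm_mult of_real_mult
      by (intro arg_cong2[where f = "(*)"] powr_norm) (auto simp: r_def)
    have T: "T (of_real (Re x)) (of_real (Re y)) t = of_real (norm (T x y t))"
      using t unfolding T_def norm_mult of_real_mult
      by (intro arg_cong2[where f = "(*)"] powr_norm) auto
    show "Re (f r (of_real (Re x)) (of_real (Re y)) t p) = norm (f s x y t p)"
      unfolding f_def P T norm_mult by (subst K) simp
  qed (use s t in \<open>auto simp: r_def\<close>)
  have g: "(g s x y has_abs_integral Mellin_factor \<nu> s * Beta (x + s) (y + s)) {0<..<1}"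
    if "Re (x + s) > 0" "Re (y + s) > 0" for s x y
    unfolding g_def by (intro has_abs_integral_mult_right has_abs_integral_Beta_complex that)
  let ?N = "Mellin_factor \<nu> r * Beta (of_real (Re x) + r) (of_real (Re y) + r)"
  have h: "((\<lambda>t. Re (g r (of_real (Re x)) (of_real (Re y)) t)) has_abs_integral Re ?N) {0<..<1}"
    using s x y \<nu> by (intro has_abs_integral_Re g) (auto simp: r_def)
  have m: "(\<lambda>(t, p). indicator {0<..<1} t *\<^sub>R indicator {0<..} p *\<^sub>R f s x y t p)
      \<in> borel_measurable (lborel \<Otimes>\<^sub>M lborel)"
    unfolding f_def P_def T_def by measurable
  have f_ext: "(LBINT t:{0<..<1}. f s x y t p) = of_real p powr (s - 1) * ext_Beta (of_real p) \<nu> x y"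
    if "p \<in> {0<..}" for p
  proof -
    \<comment> \<open>For positive \<open>p\<close> the principal root is the real one, so the
      prefactor of \<open>ext_Beta\<close> is already contained in \<open>P\<close>.\<close>
    have "csqrt (2 * of_real p / of_real pi) = of_real (sqrt (2 * p / pi))"
      using that csqrt_of_real_nonneg[of "of_real (2 * p / pi)"] by simp
    moreover have "f s x y t p = P s p * (T x y t *
        bessel_K (of_real (\<nu> + 1 / 2)) (of_real p / of_real (t * (1 - t))))" for t
      by (simp add: f_def)
    then have "(LBINT t:{0<..<1}. f s x y t p) = P s p * (LBINT t:{0<..<1}.
        T x y t * bessel_K (of_real (\<nu> + 1 / 2)) (of_real p / of_real (t * (1 - t))))"
      by (simp only: set_integral_mult_right)
    ultimately show ?thesis
      by (simp add: ext_Beta_def P_def T_def)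
  qed
  have gval: "(LBINT t:{0<..<1}. g s x y t) = Mellin_factor \<nu> s * Beta (x + s) (y + s)"
    using g[of x s y] s x y \<nu> by (simp add: has_abs_integral_iff)
  show "((\<lambda>p. complex_of_real p powr (s - 1) * ext_Beta (of_real p) \<nu> x y) has_abs_integral
        Mellin_factor \<nu> s * Beta (x + s) (y + s)) {0<..}"
    by (rule has_abs_integral_eq[OF Fubini_on_integral[OF m f[OF s] n h]])
       (simp_all add: f_ext gval)
  have "(LBINT p:{0<..}. norm (complex_of_real p powr (s - 1) * ext_Beta (of_real p) \<nu> x y))
      = (LBINT p:{0<..}. norm (LBINT t:{0<..<1}. f s x y t p))"
    by (intro set_lebesgue_integral_cong) (auto simp: f_ext)
  also have "\<dots> \<le> Re ?N"
    by (rule Fubini_on_norm[OF m f[OF s] n h])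
  also have "?N = Mellin_factor \<nu> r * of_real (Beta (Re x + Re s) (Re y + Re s))"
    by (simp add: r_def flip: Beta_complex_of_real)
  finally show "(LBINT p:{0<..}. norm (complex_of_real p powr (s - 1) * ext_Beta (of_real p) \<nu> x y))
        \<le> Re (Mellin_factor \<nu> r) * Beta (Re x + Re s) (Re y + Re s)"
    by simp
qed

section \<open>Termwise integration of the series of the extended confluent function\<close>

text \<open>By monotone convergence the sum of the norms has a finite integral, hence is finite
  almost everywhere. This is the pointwise hypothesis for exchanging sum and integral.\<close>

lemma AE_summable_norm:
  fixes f :: "nat \<Rightarrow> 'a \<Rightarrow> 'b::{banach, second_countable_topology}"
  assumes [measurable]: "\<And>i. integrable M (f i)"
    and sum: "summable (\<lambda>i. \<integral>x. norm (f i x) \<partial>M)"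
  shows "AE x in M. summable (\<lambda>i. norm (f i x))"
proof -
  have "(\<integral>\<^sup>+x. (\<Sum>i. ennreal (norm (f i x))) \<partial>M) = (\<Sum>i. ennreal (\<integral>x. norm (f i x) \<partial>M))"
    using assms(1) by (subst nn_integral_suminf) (auto intro!: nn_integral_eq_integral suminf_cong)
  also have "\<dots> \<noteq> \<infinity>"
    using sum by (subst suminf_ennreal2) auto
  finally have "AE x in M. (\<Sum>i. ennreal (norm (f i x))) \<noteq> \<infinity>"
    by (intro nn_integral_PInf_AE) measurable
  then show ?thesis
    by eventually_elim (auto intro: summable_suminf_not_top)
qed

text \<open>Both shifted Gamma values differ from the unshifted ones by Pochhammer symbols. This
  turns the Beta values of the integrated series into coefficients of
  \<open>confluent_Phi\<close>.\<close>

lemma Beta_plus_of_nat: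
  assumes "Re x > 0" "Re y > 0"
  shows "Beta (x + of_nat m) y = Beta x y * pochhammer x m / pochhammer (x + y) m"
proof -
  have *: "Gamma (z + of_nat m) = Gamma z * pochhammer z m" if "Re z > 0" for z :: complex
    using that Gamma_nonzero_Re_pos[OF that] by (subst pochhammer_Gamma) (auto elim!: nonpos_Ints_cases)
  show ?thesis
    using *[of x] *[of "x + y"] assms by (simp add: Beta_def add_ac)
qed

lemma has_abs_integral_Mellin_ext_Phi:
  assumes \<nu>: "\<nu> \<ge> 0" and s: "Re s > \<nu>" and b: "Re b > 0" and cb: "Re (c - b) > 0"
  shows "((\<lambda>p. complex_of_real p powr (s - 1) * ext_Phi (of_real p) \<nu> b c z) has_abs_integral
      Mellin_factor \<nu> s * Beta (b + s) (c - b + s) / Beta b (c - b) *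
        confluent_Phi (b + s) (c + 2 * s) z) {0<..}"
proof -
  define a where "a = (\<lambda>m. z ^ m / (fact m * Beta b (c - b)))"
  define F where "F = (\<lambda>m p. indicator {0<..} p *\<^sub>R (a m *
    (complex_of_real p powr (s - 1) * ext_Beta (of_real p) \<nu> (b + of_nat m) (c - b))))"
  have F: "has_bochner_integral lborel (F m)
      (a m * (Mellin_factor \<nu> s * Beta (b + of_nat m + s) (c - b + s)))" for m
    unfolding F_def using assms
    by (intro has_abs_integral_mult_right has_abs_integral_Mellin_ext_Beta) auto
  note F' = F[unfolded has_bochner_integral_iff]
  define N where "N = Re (Mellin_factor \<nu> (of_real (Re s)))"
  define B where "B = Beta (Re b + Re s) (Re (c - b) + Re s)"
  have N: "norm (LBINT p. norm (F m p)) \<le> norm (a m) * (\<bar>N\<bar> * B)" for m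
  proof -
    have "(LBINT p. norm (F m p)) = norm (a m) * (LBINT p:{0<..}. norm (complex_of_real p powr (s - 1) *
      ext_Beta (of_real p) \<nu> (b + of_nat m) (c - b)))"
      unfolding F_def set_lebesgue_integral_def integral_mult_right_zero[symmetric]
      by (intro Bochner_Integration.integral_cong) (simp_all add: norm_mult)
    also have "\<dots> \<le> norm (a m) * (N * Beta (Re b + real m + Re s) (Re (c - b) + Re s))"
      using norm_integral_Mellin_ext_Beta_le[OF \<nu> s, of "b + of_nat m" "c - b"] b cb
      by (intro mult_left_mono) (simp_all add: N_def)
    \<comment> \<open>The real Beta function is antitone in its first argument, so dropping
      \<open>m\<close> gives a bound independent of \<open>m\<close>. The absolute value of
      \<open>N\<close> avoids a discussion of its sign.\<close>
    also have "\<dots> \<le> norm (a m) * (\<bar>N\<bar> * B)"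
      unfolding B_def using assms
      by (intro mult_left_mono mult_mono Beta_real_mono) (auto simp: Beta_def Gamma_real_nonneg)
    finally show ?thesis by simp
  qed
  have "summable (\<lambda>m. norm (a m) * (\<bar>N\<bar> * B))"
  proof (intro summable_mult2)
    \<comment> \<open>Up to a constant these are the norms of the terms of the exponential
      series.\<close>
    have "norm (a m) = norm (inverse (Beta b (c - b))) * norm (z ^ m /\<^sub>R fact m)" for m
      by (simp add: a_def norm_divide norm_mult norm_inverse divide_inverse)
    then show "summable (\<lambda>m. norm (a m))"
      using summable_mult[OF summable_norm_exp[of z], of "norm (inverse (Beta b (c - b)))"]
      by (simp only:)
  qed
  then have sum: "summable (\<lambda>m. LBINT p. norm (F m p))"
    by (rule summable_comparison_test') (use N in blast)
  note AE = AE_summable_norm[OF conjunct1[OF F'] sum]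
  have int: "integrable lborel (\<lambda>p. \<Sum>m. F m p)"
    by (rule integrable_suminf[OF conjunct1[OF F'] AE sum])
  have "(\<lambda>m. a m * (Mellin_factor \<nu> s * Beta (b + of_nat m + s) (c - b + s))) sums (LBINT p. \<Sum>m. F m p)"
    using sums_integral[OF conjunct1[OF F'] AE sum] F' by simp
  moreover define K where "K = Mellin_factor \<nu> s * Beta (b + s) (c - b + s) / Beta b (c - b)"
  have "a m * (Mellin_factor \<nu> s * Beta (b + of_nat m + s) (c - b + s)) =
      K * (pochhammer (b + s) m / pochhammer (c + 2 * s) m * z ^ m / fact m)" for m
  proof -
    have eqs: "b + s + of_nat m = b + of_nat m + s" "b + s + (c - b + s) = c + 2 * s" by simp_all
    have "Beta (b + of_nat m + s) (c - b + s) =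
        Beta (b + s) (c - b + s) * pochhammer (b + s) m / pochhammer (c + 2 * s) m"
      using Beta_plus_of_nat[of "b + s" "c - b + s" m] assms unfolding eqs by simp
    then show ?thesis
      by (simp only: a_def K_def divide_inverse inverse_mult_distrib mult_ac)
  qed
  ultimately have sums: "(\<lambda>m. K * (pochhammer (b + s) m / pochhammer (c + 2 * s) m * z ^ m / fact m))
      sums (LBINT p. \<Sum>m. F m p)" by simp
  \<comment> \<open>A nonzero \<open>K\<close> lets summability pass from the integrated series to
    the confluent series itself, so that \<open>K\<close> can be pulled out of the sum.\<close>
  have "K \<noteq> 0"
    using assms by (auto simp: K_def Mellin_factor_def Beta_def intro!: Gamma_nonzero_Re_pos)
  with sums_summable[OF sums]
  have "summable (\<lambda>m. pochhammer (b + s) m / pochhammer (c + 2 * s) m * z ^ m / fact m)"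
    by (simp only: summable_cmult_iff) simp
  then have val: "(LBINT p. \<Sum>m. F m p) = K * confluent_Phi (b + s) (c + 2 * s) z"
    unfolding confluent_Phi_def sums_unique[OF sums] by (rule suminf_mult)
  have "has_bochner_integral lborel (\<lambda>p. \<Sum>m. F m p) (K * confluent_Phi (b + s) (c + 2 * s) z)"
    using int val by (simp add: has_bochner_integral_iff)
  moreover have "AE p in lborel. (\<Sum>m. F m p) = indicator {0<..} p *\<^sub>R
      (complex_of_real p powr (s - 1) * ext_Phi (of_real p) \<nu> b c z)"
    using AE
  proof eventually_elim
    case (elim p)
    show ?case
    proof (cases "p > 0")
      case True
      then have Fp: "F m p = complex_of_real p powr (s - 1) *
          (ext_Beta (of_real p) \<nu> (b + of_nat m) (c - b) / Beta b (c - b) * z ^ m / fact m)" for m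
        by (simp add: F_def a_def) (simp only: divide_inverse inverse_mult_distrib mult_ac)
      have "summable (\<lambda>m. F m p)"
        using elim by (rule summable_norm_cancel)
      then have "summable (\<lambda>m. ext_Beta (of_real p) \<nu> (b + of_nat m) (c - b) / Beta b (c - b) * z ^ m / fact m)"
        unfolding Fp summable_cmult_iff using True by simp
      then have "(\<Sum>m. F m p) = complex_of_real p powr (s - 1) * ext_Phi (of_real p) \<nu> b c z"
        unfolding Fp ext_Phi_def by (rule suminf_mult)
      with True show ?thesis by simp
    qed (simp add: F_def)
  qed
  \<comment> \<open>Equality almost everywhere does not carry Borel measurability over, since
    \<open>lborel\<close> is not complete. It is therefore shown separately, from the measurability
    of each term.\<close>
  moreover have "(\<lambda>p. indicator {0<..} p *\<^sub>R
      (complex_of_real p powr (s - 1) * ext_Phi (of_real p) \<nu> b c z)) \<in> borel_measurable lborel"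
  proof -
    define E where "E = (\<lambda>m p. indicator {0<..} p *\<^sub>R
      (complex_of_real p powr (s - 1) * ext_Beta (of_real p) \<nu> (b + of_nat m) (c - b)))"
    have E[measurable]: "E m \<in> borel_measurable lborel" for m
      unfolding E_def using assms
      by (intro borel_measurable_has_bochner_integral[OF has_abs_integral_Mellin_ext_Beta]) auto
    \<comment> \<open>Each \<open>E m\<close> is measurable by its Mellin transform. The power
      \<open>1 - s\<close> removes the weight again and recovers \<open>ext_Beta\<close> for
      positive \<open>p\<close>.\<close>
    have "indicator {0<..} p *\<^sub>R (complex_of_real p powr (s - 1) * ext_Phi (of_real p) \<nu> b c z) =
        indicator {0<..} p *\<^sub>R (complex_of_real p powr (s - 1) *
          (\<Sum>m. of_real p powr (1 - s) * E m p / Beta b (c - b) * z ^ m / fact m))" for p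
    proof (cases "p > 0")
      case True
      then have "complex_of_real p powr (1 - s) * of_real p powr (s - 1) = 1"
        by (simp flip: powr_add)
      with True have "of_real p powr (1 - s) * E m p = ext_Beta (of_real p) \<nu> (b + of_nat m) (c - b)" for m
        by (simp add: E_def flip: mult.assoc)
      then show ?thesis by (simp only: ext_Phi_def)
    qed simp
    then show ?thesis by (simp only:) measurable
  qed
  ultimately have "has_bochner_integral lborel (\<lambda>p. indicator {0<..} p *\<^sub>R
      (complex_of_real p powr (s - 1) * ext_Phi (of_real p) \<nu> b c z)) (K * confluent_Phi (b + s) (c + 2 * s) z)"
    using has_bochner_integral_cong_AE borel_measurable_has_bochner_integral by blast
  then show ?thesis by (simp add: K_def)
qed

theorem theorem4:
  fixes \<nu> :: real and z \<kappa> \<mu> s :: complex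
  assumes "\<nu> \<ge> 0" and "z \<noteq> 0" and "- pi < Arg z" and "Arg z \<le> pi"
    and "Re s > \<nu>"
    and "Re (\<mu> + \<kappa> + 1 / 2) > 0" and "Re (\<mu> - \<kappa> + 1 / 2) > 0"
  shows "set_integrable lborel {0<..}
           (\<lambda>p. complex_of_real p powr (s - 1) * ext_Whittaker_M (of_real p) \<nu> \<kappa> \<mu> z)
       \<and> (LBINT p:{0<..}. complex_of_real p powr (s - 1) * ext_Whittaker_M (of_real p) \<nu> \<kappa> \<mu> z) =
           2 powr (s - 1) * z powr (\<mu> + 1 / 2) * exp (- z / 2)
             / (of_real (sqrt pi) * Beta (\<mu> - \<kappa> + 1 / 2) (\<mu> + \<kappa> + 1 / 2))
           * Gamma ((s - of_real \<nu>) / 2) * Gamma ((s + of_real \<nu> + 1) / 2)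
           * Beta (\<mu> - \<kappa> + s + 1 / 2) (\<mu> + \<kappa> + s + 1 / 2)
           * confluent_Phi (\<mu> - \<kappa> + s + 1 / 2) (2 * \<mu> + 2 * s + 1) z"
proof -
  \<comment> \<open>With \<open>b = \<mu> - \<kappa> + 1 / 2\<close> and
    \<open>c = 2 * \<mu> + 1\<close>, the difference \<open>c - b\<close> is
    \<open>\<mu> + \<kappa> + 1 / 2\<close>. The two conditions on real parts are thus those on
    \<open>b\<close> and \<open>c - b\<close>.\<close>
  have params: "2 * \<mu> + 1 - (\<mu> - \<kappa> + 1 / 2) = \<mu> + \<kappa> + 1 / 2"
    "\<mu> - \<kappa> + 1 / 2 + s = \<mu> - \<kappa> + s + 1 / 2"
    "\<mu> + \<kappa> + 1 / 2 + s = \<mu> + \<kappa> + s + 1 / 2"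
    "2 * \<mu> + 1 + 2 * s = 2 * \<mu> + 2 * s + 1"
    by (simp_all add: algebra_simps)
  have "((\<lambda>p. complex_of_real p powr (s - 1) *
        ext_Phi (of_real p) \<nu> (\<mu> - \<kappa> + 1 / 2) (2 * \<mu> + 1) z) has_abs_integral
      Mellin_factor \<nu> s * Beta (\<mu> - \<kappa> + s + 1 / 2) (\<mu> + \<kappa> + s + 1 / 2)
        / Beta (\<mu> - \<kappa> + 1 / 2) (\<mu> + \<kappa> + 1 / 2)
        * confluent_Phi (\<mu> - \<kappa> + s + 1 / 2) (2 * \<mu> + 2 * s + 1) z) {0<..}"
    using has_abs_integral_Mellin_ext_Phi[of \<nu> s "\<mu> - \<kappa> + 1 / 2" "2 * \<mu> + 1" z] assms
    unfolding params by blast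
  \<comment> \<open>The Whittaker prefactor is independent of \<open>p\<close> and enters as a
    constant multiple.\<close>
  from has_abs_integral_mult_right[OF this, of "z powr (\<mu> + 1 / 2) * exp (- z / 2)"]
  show ?thesis
    unfolding has_abs_integral_iff[symmetric]
    by (rule has_abs_integral_eq)
       (simp_all add: ext_Whittaker_M_def Mellin_factor_def mult_ac)
qed

end
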